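(* Let $A,B\in\mathcal M_{nm}$. Then $\mathcal M_{mn}^A\cong\mathcal M_{mn}^B$ (as semigroups) if and only if $\operatorname{rank}(A)=\operatorname{rank}(B)$.
   Context: Let $\mathbb F$ be a field and $m,n\geq1$ integers. $\mathcal M_{kl}$ denotes the set of all $k\times l$ matrices over $\mathbb F$. For $A\in\mathcal M_{nm}$, the linear sandwich semigroup $\mathcal M_{mn}^A$ has underlying set $\mathcal M_{mn}$ and operation $X\star_AY=XAY$. *)

theory Defs
  imports "HOL-Analysis.Analysis"
begin

text \<open>
  In \<^typ>\<open>'a^'n^'m\<close> the outer index \<open>'m\<close> runs over rows, so this type is
  the full set of \<open>m \<times> n\<close> matrices with \<open>m = CARD('m)\<close> and
  \<open>n = CARD('n)\<close>; both cardinalities are automatically at least 1.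
\<close>

definition sandwich_mult ::
    "'a::field^'m^'n \<Rightarrow> 'a^'n^'m \<Rightarrow> 'a^'n^'m \<Rightarrow> 'a^'n^'m" where
  "sandwich_mult A X Y = X ** A ** Y"

lemma semigroup_sandwich_mult: "semigroup (sandwich_mult A)"
  by unfold_locales (simp add: sandwich_mult_def matrix_mul_assoc)

text \<open>
  Semigroups are given by their operations in the sense of the locale
  \<^locale>\<open>semigroup\<close>, so the underlying sets are the full types.
\<close>

definition semigroup_isomorphic ::
    "('a \<Rightarrow> 'a \<Rightarrow> 'a) \<Rightarrow> ('b \<Rightarrow> 'b \<Rightarrow> 'b) \<Rightarrow> bool" where
  "semigroup_isomorphic f g \<longleftrightarrow>
    (\<exists>\<phi>. bij \<phi> \<and> (\<forall>x y. \<phi> (f x y) = g (\<phi> x) (\<phi> y)))"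

end

theory Submission
  imports Defs
begin

text \<open>
  The rank of \<open>A\<close> can be read off the semigroup: it is the largest size of a family of nonzero
  idempotents whose pairwise products vanish. If \<open>e\<close> runs through such a family and \<open>e w\<^sub>e \<noteq> 0\<close>,
  then the vectors \<open>A e w\<^sub>e\<close> are linearly independent; conversely, a basis of the column
  space of \<open>A\<close> with its coordinate functionals gives a family of that size. If the ranks
  agree, then \<open>B Q = P A\<close> with \<open>P\<close> and \<open>Q\<close> invertible, and \<open>X \<mapsto> Q X P\<^sup>-\<^sup>1\<close> is an isomorphism.
\<close>

section \<open>Orthogonal families of idempotents and the bound on their size\<close>

text \<open>Only the operation and a candidate zero \<open>z\<close> enter, so the notion can be
  carried along any injective multiplicative map.\<close>

definition orthogonal_idempotents :: "('s \<Rightarrow> 's \<Rightarrow> 's) \<Rightarrow> 's \<Rightarrow> 's set \<Rightarrow> bool" where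
  "orthogonal_idempotents f z S \<longleftrightarrow>
    finite S \<and> z \<notin> S \<and> (\<forall>x\<in>S. \<forall>y\<in>S. f x y = (if x = y then x else z))"

lemma orthogonal_idempotents_image:
  assumes S: "orthogonal_idempotents f z S" and "inj \<phi>"
    and \<phi>: "\<And>x y. \<phi> (f x y) = g (\<phi> x) (\<phi> y)"
  shows "orthogonal_idempotents g (\<phi> z) (\<phi> ` S)"
proof -
  have "g (\<phi> x) (\<phi> y) = (if \<phi> x = \<phi> y then \<phi> x else \<phi> z)" if "x \<in> S" "y \<in> S" for x y
    using S that \<open>inj \<phi>\<close> by (simp add: orthogonal_idempotents_def inj_eq \<phi>[symmetric])
  then show ?thesis
    using S \<open>inj \<phi>\<close> by (simp add: orthogonal_idempotents_def inj_image_mem_iff)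
qed

text \<open>Transposition reverses products, but the defining condition is symmetric in its two
  elements, so the reversal does no harm. This serves to compare row rank and column rank.\<close>

lemma orthogonal_idempotents_transpose:
  fixes A :: "'a::field^'m^'n"
  assumes "orthogonal_idempotents (sandwich_mult A) 0 S"
  shows "orthogonal_idempotents (sandwich_mult (transpose A)) 0 (transpose ` S)"
proof -
  have inj: "inj (transpose :: 'a^'n^'m \<Rightarrow> _)"
    by (metis injI transpose_transpose)
  have zero: "transpose (0 :: 'a^'n^'m) = 0"
    by (simp add: transpose_def vec_eq_iff)
  have "transpose (sandwich_mult A y x) = sandwich_mult (transpose A) (transpose x) (transpose y)"
    for x y
    by (simp add: sandwich_mult_def matrix_transpose_mul matrix_mul_assoc)
  moreover have "orthogonal_idempotents (\<lambda>x y. sandwich_mult A y x) 0 S"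
    using assms by (auto simp: orthogonal_idempotents_def)
  ultimately show ?thesis
    using orthogonal_idempotents_image[of _ 0 S transpose] inj zero by metis
qed

lemma card_orthogonal_idempotents_le:
  fixes A :: "'a::field^'m^'n"
  assumes "orthogonal_idempotents (sandwich_mult A) 0 S"
  shows "card S \<le> vec.dim (range ((*v) A))"
proof -
  have fin: "finite S" and nz: "0 \<notin> S"
    and mult: "\<And>x y. x \<in> S \<Longrightarrow> y \<in> S \<Longrightarrow> x ** A ** y = (if x = y then x else 0)"
    using assms by (auto simp: orthogonal_idempotents_def sandwich_mult_def)
  have "\<exists>w. e *v w \<noteq> 0" if "e \<in> S" for e
    using nz that matrix_eq[of e 0] by auto
  then obtain w where w: "\<And>e. e \<in> S \<Longrightarrow> e *v w e \<noteq> 0"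
    by metis
  define u where "u e = A *v (e *v w e)" for e
  \<comment> \<open>Each \<open>e\<close> annihilates every \<open>u d\<close> with \<open>d\<close>
    different from \<open>e\<close>. Applied to a linear relation among the vectors
    \<open>u d\<close>, it therefore isolates a single coefficient.\<close>
  have eu: "e *v u d = (if e = d then e *v w e else 0)" if "e \<in> S" "d \<in> S" for e d
  proof -
    have "e *v u d = (e ** A ** d) *v w d"
      by (simp add: u_def matrix_vector_mul_assoc matrix_mul_assoc)
    then show ?thesis
      using mult[OF that] by simp
  qed
  have inj: "inj_on u S"
    using eu w by (metis inj_onI)
  have "vec.independent (u ` S)"
  proof (rule vec.independent_if_scalars_zero)
    fix c x
    assume sum: "(\<Sum>x\<in>u ` S. c x *s x) = 0" and "x \<in> u ` S"
    then obtain e where e: "e \<in> S" "x = u e"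
      by blast
    have "0 = e *v (\<Sum>d\<in>S. c (u d) *s u d)"
      using sum by (simp add: sum.reindex[OF inj])
    also have "\<dots> = (\<Sum>d\<in>S. c (u d) *s (e *v u d))"
      by (simp add: vec.sum vec.scale)
    also have "\<dots> = (\<Sum>d\<in>S. if e = d then c (u d) *s (e *v w e) else 0)"
      using eu[OF e(1)] by (intro sum.cong) auto
    also have "\<dots> = c x *s (e *v w e)"
      using e fin by simp
    finally show "c x = 0"
      using w[OF e(1)] by simp
  qed (use fin in simp)
  moreover have "u ` S \<subseteq> range ((*v) A)"
    by (auto simp: u_def)
  ultimately have "card (u ` S) \<le> vec.dim (range ((*v) A))"
    by (intro vec.independent_card_le_dim)
  then show ?thesis
    by (simp add: card_image[OF inj])
qed

section \<open>Generalized inverses and a family attaining the bound\<close>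

lemma subspace_range_matrix: "vec.subspace (range ((*v) (A :: 'a::field^'m^'n)))"
  using vec.subspace_image vec.subspace_UNIV by blast

text \<open>The linear map given by \<open>A\<close> has a linear right inverse on its range, whose
  matrix serves as \<open>S\<close>. Below it acts as a linear section of \<open>A\<close> over the
  column space.\<close>

lemma matrix_von_Neumann_regular:
  fixes A :: "'a::field^'m^'n"
  shows "\<exists>S. A ** S ** A = A"
proof -
  obtain s where s: "Vector_Spaces.linear (*s) (*s) s" "\<forall>y\<in>range ((*v) A). A *v s y = y"
    using vec.linear_exists_right_inverse_on[OF matrix_vector_mul_linear_gen[of A] vec.subspace_UNIV]
    by blast
  then have "A ** matrix s ** A = A"
    by (simp add: matrix_eq matrix_works flip: matrix_vector_mul_assoc)
  then show ?thesis ..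
qed

lemma orthogonal_idempotents_exists:
  fixes A :: "'a::field^'m^'n"
  obtains S where "orthogonal_idempotents (sandwich_mult A) 0 S"
    "card S = vec.dim (range ((*v) A))"
proof -
  obtain C where C: "finite C" "C \<subseteq> range ((*v) A)" "vec.independent C"
      "card C = vec.dim (range ((*v) A))"
    using vec.basis_subspace_exists[OF subspace_range_matrix[of A]] by metis
  obtain s where "A ** s ** A = A"
    using matrix_von_Neumann_regular by blast
  then have s: "A *v (s *v y) = y" if "y \<in> range ((*v) A)" for y
    using that by (auto simp: matrix_vector_mul_assoc matrix_mul_assoc)
  \<comment> \<open>For \<open>b\<close> in \<open>C\<close>, this is a projection onto the line
    through \<open>b\<close> that kills the other basis vectors; it encodes the coordinate
    functional of \<open>b\<close>.\<close>
  have "\<exists>P :: 'a^'n^'n. (\<forall>c\<in>C. P *v c = (if c = b then b else 0)) \<and> (\<forall>w. \<exists>k. P *v w = k *s b)"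
    for b
  proof -
    obtain g where g: "Vector_Spaces.linear (*s) (*s) g" "\<forall>c\<in>C. g c = (if c = b then b else 0)"
        "range g = vec.span ((\<lambda>c. if c = b then b else 0) ` C)"
      using vec.linear_independent_extend_subspace[OF C(3),
          of "\<lambda>c. if c = b then b else 0"] by blast
    have "range g \<subseteq> vec.span {b}"
      unfolding g(3)
      by (rule vec.span_minimal) (auto simp: vec.span_base vec.span_zero vec.subspace_span)
    then have "\<exists>k. g w = k *s b" for w
      by (auto simp: vec.span_singleton)
    then show ?thesis
      using g(1,2) by (intro exI[of _ "matrix g"]) (simp add: matrix_works)
  qed
  then obtain P :: "'a^'n \<Rightarrow> 'a^'n^'n"
    where P: "\<And>b c. c \<in> C \<Longrightarrow> P b *v c = (if c = b then b else 0)"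
      and k: "\<And>b w. \<exists>k. P b *v w = k *s b"
    by metis
  \<comment> \<open>The section \<open>s\<close> moves the projection to the shape of a semigroup
    element. In \<open>e b ** A ** e c\<close> the inner \<open>A ** s\<close> fixes the line
    through \<open>c\<close>, so the product behaves like that of two projections.\<close>
  define e where "e b = s ** P b" for b
  have nz: "b \<noteq> 0" if "b \<in> C" for b
    using C(3) that vec.dependent_zero by metis
  have e_b: "e b *v c = (if c = b then s *v b else 0)" if "c \<in> C" for b c
    using P[OF that] by (simp add: e_def flip: matrix_vector_mul_assoc)
  have sb: "s *v b \<noteq> 0" if "b \<in> C" for b
    using s[of b] C(2) nz[OF that] that by auto
  have inj: "inj_on e C"
    using e_b sb by (metis inj_onI)
  have "e b ** A ** e c = (if b = c then e b else 0)" if "b \<in> C" "c \<in> C" for b c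
  proof (subst matrix_eq, rule allI)
    fix w
    obtain k where k: "P c *v w = k *s c"
      using k by blast
    have "A *v (s *v c) = c"
      using s C(2) that by blast
    then have "(e b ** A ** e c) *v w = e b *v (k *s c)"
      by (simp add: e_def k vec.scale flip: matrix_vector_mul_assoc)
    also have "\<dots> = (if b = c then e b else 0) *v w"
      using k e_b[OF that(2), of b] by (auto simp: vec.scale e_def simp flip: matrix_vector_mul_assoc)
    finally show "(e b ** A ** e c) *v w = (if b = c then e b else 0) *v w" .
  qed
  moreover have "0 \<notin> e ` C"
    using e_b sb by (metis (no_types, lifting) imageE matrix_vector_mult_0)
  ultimately have "orthogonal_idempotents (sandwich_mult A) 0 (e ` C)"
    using C(1) inj unfolding orthogonal_idempotents_def sandwich_mult_def
    by (auto simp: inj_on_eq_iff)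
  then show thesis
    using that card_image[OF inj] C(4) by metis
qed

section \<open>The rank as column rank, and its invariance\<close>

lemma rank_eq_dim_range:
  fixes A :: "'a::field^'m^'n"
  shows "rank A = vec.dim (range ((*v) A))"
proof -
  \<comment> \<open>A largest family for \<open>A\<close> transposes to a family for
    \<open>transpose A\<close>, which the bound limits. The shape is arbitrary because
    \<open>A\<close> and \<open>transpose A\<close> are both inserted later.\<close>
  have le: "vec.dim (range ((*v) A)) \<le> vec.dim (range ((*v) (transpose A)))"
    for A :: "'a^'k^'l"
  proof -
    obtain S where S: "orthogonal_idempotents (sandwich_mult A) 0 S"
        "card S = vec.dim (range ((*v) A))"
      using orthogonal_idempotents_exists[of A] .
    have "card (transpose ` S) = card S"
      by (metis card_image inj_onI transpose_transpose)
    then show ?thesis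
      using card_orthogonal_idempotents_le[OF orthogonal_idempotents_transpose[OF S(1)]] S(2)
      by simp
  qed
  have "range ((*v) (transpose A)) = vec.span (rows A)"
  proof
    show "range ((*v) (transpose A)) \<subseteq> vec.span (rows A)"
      using matrix_vector_mult_in_columnspace_gen[of "transpose A"]
      by (auto simp: columns_transpose)
    have "row i A = transpose A *v axis i 1" for i
      by (simp add: vec_eq_iff row_def transpose_def matrix_vector_mult_def axis_def if_distrib
          cong: if_cong)
    then show "vec.span (rows A) \<subseteq> range ((*v) (transpose A))"
      by (intro vec.span_minimal subspace_range_matrix) (auto simp: rows_def)
  qed
  then have "rank A = vec.dim (range ((*v) (transpose A)))"
    by (simp add: row_rank_def_gen)
  then show ?thesis
    using le[of A] le[of "transpose A"] by simp
qed

lemma rank_le_if_semigroup_isomorphic: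
  fixes A B :: "'a::field^'m^'n"
  assumes "semigroup_isomorphic (sandwich_mult A) (sandwich_mult B)"
  shows "rank A \<le> rank B"
proof -
  obtain \<phi> where "bij \<phi>" and \<phi>: "\<And>x y. \<phi> (sandwich_mult A x y) = sandwich_mult B (\<phi> x) (\<phi> y)"
    using assms by (auto simp: semigroup_isomorphic_def)
  \<comment> \<open>Although \<open>\<phi>\<close> need not be linear, it preserves zero: zero is
    absorbing, so the image of the product of \<open>0\<close> and \<open>z\<close> is both
    \<open>\<phi> 0\<close> and \<open>0\<close>.\<close>
  obtain z where "\<phi> z = 0"
    using \<open>bij \<phi>\<close> by (metis bij_pointE)
  then have zero: "\<phi> 0 = 0"
    using \<phi>[of 0 z] by (simp add: sandwich_mult_def)
  obtain S where S: "orthogonal_idempotents (sandwich_mult A) 0 S" "card S = rank A"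
    using orthogonal_idempotents_exists[of A] by (metis rank_eq_dim_range)
  have "orthogonal_idempotents (sandwich_mult B) 0 (\<phi> ` S)"
    using orthogonal_idempotents_image[OF S(1) bij_is_inj[OF \<open>bij \<phi>\<close>], of "sandwich_mult B"] \<phi> zero
    by simp
  then have "card (\<phi> ` S) \<le> rank B"
    using card_orthogonal_idempotents_le by (simp add: rank_eq_dim_range)
  moreover have "card (\<phi> ` S) = card S"
    using bij_is_inj[OF \<open>bij \<phi>\<close>] by (intro card_image) (rule inj_on_subset, auto)
  ultimately show ?thesis
    using S(2) by simp
qed

section \<open>Matrices of equal rank are equivalent\<close>

text \<open>The space is the direct sum of the kernel and the image of the column space under a
  section \<open>s\<close>, which is injective there. Equal ranks thus force kernels of equal
  dimension.\<close>

lemma rank_nullity: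
  fixes A :: "'a::field^'m^'n"
  shows "vec.dim {x. A *v x = 0} + rank A = CARD('m)"
proof -
  let ?K = "{x. A *v x = 0}" and ?R = "range ((*v) A)"
  obtain s where "A ** s ** A = A"
    using matrix_von_Neumann_regular by blast
  then have s: "A *v (s *v y) = y" if "y \<in> ?R" for y
    using that by (auto simp: matrix_vector_mul_assoc matrix_mul_assoc)
  have subK: "vec.subspace ?K"
    by (rule vec.subspace_kernel)
  have subR: "vec.subspace ((*v) s ` ?R)"
    by (intro vec.subspace_image subspace_range_matrix)
  have "inj_on ((*v) s) ?R"
    using s by (metis inj_onI)
  then have dim: "vec.dim ((*v) s ` ?R) = rank A"
    using vec.dim_image_eq[OF matrix_vector_mul_linear_gen[of s], of ?R]
      vec.span_eq_iff[THEN iffD2, OF subspace_range_matrix[of A]]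
    by (simp add: rank_eq_dim_range)
  have "x \<in> {x + y |x y. x \<in> ?K \<and> y \<in> (*v) s ` ?R}" for x
  proof -
    have "x = (x - s *v (A *v x)) + s *v (A *v x)" "x - s *v (A *v x) \<in> ?K"
      using s by (simp_all add: vec.diff)
    then show ?thesis
      by blast
  qed
  then have sums: "{x + y |x y. x \<in> ?K \<and> y \<in> (*v) s ` ?R} = UNIV"
    by blast
  have "?K \<inter> (*v) s ` ?R \<subseteq> {0}"
    using s by auto
  then have "vec.dim (?K \<inter> (*v) s ` ?R) = 0"
    by (simp add: vec.dim_eq_0)
  then show ?thesis
    using vec.dim_sums_Int[OF subK subR] unfolding sums dim vec_dim_card by linarith
qed

lemma invertible_if_injective:
  fixes Q :: "'a::field^'m^'m"
  assumes "\<And>x. Q *v x = 0 \<Longrightarrow> x = 0"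
  shows "invertible Q"
  using assms by (simp add: invertible_left_inverse matrix_left_invertible_ker)

text \<open>\<open>P\<close> extends an isomorphism between the column spaces. \<open>Q\<close> is
  assembled from a lift of \<open>P\<close> through \<open>B\<close> and an isomorphism between the
  kernels.\<close>

lemma equal_rank_imp_equivalent:
  fixes A B :: "'a::field^'m^'n"
  assumes "rank A = rank B"
  obtains P :: "'a^'n^'n" and Q :: "'a^'m^'m"
  where "invertible P" "invertible Q" "B ** Q = P ** A"
proof -
  let ?RA = "range ((*v) A)" and ?RB = "range ((*v) B)"
  let ?KA = "{x. A *v x = 0}" and ?KB = "{x. B *v x = 0}"
  obtain C where C: "C \<subseteq> ?RA" "vec.independent C" "vec.span C = ?RA" "card C = vec.dim ?RA"
    using vec.basis_subspace_exists[OF subspace_range_matrix[of A]] by metis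
  obtain f where f: "Vector_Spaces.linear (*s) (*s) f" "f ` ?RA = ?RB" "inj_on f ?RA"
    using vec.subspace_isomorphism[OF subspace_range_matrix[of A] subspace_range_matrix[of B]] assms
    by (auto simp: rank_eq_dim_range)
  have "vec.independent (f ` C)"
    using vec.linear_independent_injective_image[OF f(1) C(2)] f(3) C(3) by simp
  \<comment> \<open>The map \<open>f\<close> is controlled only on the column space of
    \<open>A\<close>; keeping its values on a basis there, \<open>p\<close> is injective
    everywhere.\<close>
  then obtain p where p: "Vector_Spaces.linear (*s) (*s) p" "inj p" "\<forall>x\<in>C. p x = f x"
    using vec.linear_independent_extend_inj[OF C(2) _ inj_on_subset[OF f(3) C(1)]] by blast
  have pf: "p y = f y" if "y \<in> ?RA" for y
    using vec.linear_eq_on[OF p(1) f(1)] that p(3) C(3) by blast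
  define P where "P = matrix p"
  have P: "P *v x = p x" for x
    by (simp add: P_def matrix_works p(1))
  have "invertible P"
    by (rule invertible_if_injective) (metis P injD[OF p(2)] vec.zero)
  have PA: "P *v (A *v x) \<in> ?RB" for x
    using f(2) pf P by (metis imageI rangeI)

  have "vec.dim ?KA = vec.dim ?KB"
    using rank_nullity[of A] rank_nullity[of B] assms by simp
  then obtain h where h: "Vector_Spaces.linear (*s) (*s) h" "h ` ?KA = ?KB" "inj_on h ?KA"
    using vec.subspace_isomorphism[OF vec.subspace_kernel[of A] vec.subspace_kernel[of B]] by auto
  define H where "H = matrix h"
  have H: "H *v x = h x" for x
    by (simp add: H_def matrix_works h(1))
  obtain s where "A ** s ** A = A"
    using matrix_von_Neumann_regular by blast
  then have s: "A *v (s *v y) = y" if "y \<in> ?RA" for y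
    using that by (auto simp: matrix_vector_mul_assoc matrix_mul_assoc)
  obtain t where "B ** t ** B = B"
    using matrix_von_Neumann_regular by blast
  then have t: "B *v (t *v y) = y" if "y \<in> ?RB" for y
    using that by (auto simp: matrix_vector_mul_assoc matrix_mul_assoc)
  \<comment> \<open>Split \<open>x\<close> into \<open>s *v (A *v x)\<close> and a remainder in the
    kernel of \<open>A\<close>. The first part goes to the preimage under \<open>B\<close> of
    \<open>P *v (A *v x)\<close> chosen by \<open>t\<close>, the second into the kernel of
    \<open>B\<close> by \<open>H\<close>.\<close>
  define Q where "Q = t ** P ** A + H ** (mat 1 - s ** A)"
  have Q: "Q *v x = t *v (P *v (A *v x)) + H *v (x - s *v (A *v x))" for x
    by (simp add: Q_def matrix_vector_mult_add_rdistrib matrix_vector_mult_diff_rdistrib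
        flip: matrix_vector_mul_assoc)
  have BQ: "B *v (Q *v x) = P *v (A *v x)" for x
  proof -
    have "x - s *v (A *v x) \<in> ?KA"
      by (simp add: vec.diff s)
    then have "H *v (x - s *v (A *v x)) \<in> ?KB"
      using h(2) H by blast
    then show ?thesis
      by (simp add: Q vec.add t[OF PA])
  qed
  have "invertible Q"
  proof (rule invertible_if_injective)
    fix x
    assume "Q *v x = 0"
    then have "P *v (A *v x) = 0"
      using BQ[of x] by simp
    then have "A *v x = 0"
      using injD[OF p(2), of "A *v x" 0] P by (metis vec.zero)
    \<comment> \<open>Once \<open>A *v x\<close> vanishes, \<open>x\<close> is its own kernel part
      and \<open>Q *v x\<close> reduces to \<open>h x\<close>.\<close>
    then have "h x = h 0"
      using \<open>Q *v x = 0\<close> Q[of x] H[of 0] by (simp add: H)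
    then show "x = 0"
      using h(3) \<open>A *v x = 0\<close> by (simp add: inj_on_def)
  qed
  moreover have "B ** Q = P ** A"
    using BQ by (simp add: matrix_eq flip: matrix_vector_mul_assoc)
  ultimately show thesis
    using that \<open>invertible P\<close> by blast
qed

text \<open>In the product of two images under \<open>\<phi>\<close> the middle factor is
  \<open>P' ** B ** Q\<close>, which collapses to \<open>A\<close> because \<open>B ** Q\<close> is
  \<open>P ** A\<close>.\<close>

lemma semigroup_isomorphic_if_equivalent:
  fixes A B :: "'a::field^'m^'n" and P :: "'a^'n^'n" and Q :: "'a^'m^'m"
  assumes "invertible P" "invertible Q" and BQ: "B ** Q = P ** A"
  shows "semigroup_isomorphic (sandwich_mult A) (sandwich_mult B)"
proof -
  obtain P' where P': "P ** P' = mat 1" "P' ** P = mat 1"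
    using \<open>invertible P\<close> by (auto simp: invertible_def)
  obtain Q' where Q': "Q ** Q' = mat 1" "Q' ** Q = mat 1"
    using \<open>invertible Q\<close> by (auto simp: invertible_def)
  define \<phi> where "\<phi> X = Q ** X ** P'" for X :: "'a^'n^'m"
  have "bij \<phi>"
  proof (rule o_bij)
    have "Q' ** (Q ** X ** P') ** P = (Q' ** Q) ** X ** (P' ** P)"
      "Q ** (Q' ** X ** P) ** P' = (Q ** Q') ** X ** (P ** P')" for X
      by (simp_all only: matrix_mul_assoc)
    then show "(\<lambda>X. Q' ** X ** P) \<circ> \<phi> = id" "\<phi> \<circ> (\<lambda>X. Q' ** X ** P) = id"
      by (simp_all add: fun_eq_iff \<phi>_def P' Q')
  qed
  moreover have "\<phi> (sandwich_mult A X Y) = sandwich_mult B (\<phi> X) (\<phi> Y)" for X Y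
  proof -
    have "sandwich_mult B (\<phi> X) (\<phi> Y) = Q ** X ** P' ** (B ** Q) ** Y ** P'"
      by (simp add: sandwich_mult_def \<phi>_def matrix_mul_assoc)
    also have "\<dots> = Q ** X ** (P' ** P) ** A ** Y ** P'"
      by (simp only: BQ matrix_mul_assoc)
    also have "\<dots> = \<phi> (sandwich_mult A X Y)"
      by (simp add: P' sandwich_mult_def \<phi>_def matrix_mul_assoc)
    finally show ?thesis ..
  qed
  ultimately show ?thesis
    by (auto simp: semigroup_isomorphic_def)
qed

lemma semigroup_isomorphic_sym:
  assumes "semigroup_isomorphic f g"
  shows "semigroup_isomorphic g f"
proof -
  obtain \<phi> where "bij \<phi>" and \<phi>: "\<And>x y. \<phi> (f x y) = g (\<phi> x) (\<phi> y)"
    using assms by (auto simp: semigroup_isomorphic_def)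
  have "inv \<phi> (g x y) = f (inv \<phi> x) (inv \<phi> y)" for x y
    using \<phi>[of "inv \<phi> x" "inv \<phi> y"] \<open>bij \<phi>\<close>
    by (metis bij_inv_eq_iff)
  then show ?thesis
    using bij_imp_bij_inv[OF \<open>bij \<phi>\<close>] by (auto simp: semigroup_isomorphic_def)
qed

theorem corollary4p8:
  fixes A B :: "'a::field^'m^'n"
  shows "semigroup_isomorphic (sandwich_mult A) (sandwich_mult B) \<longleftrightarrow> rank A = rank B"
proof
  assume iso: "semigroup_isomorphic (sandwich_mult A) (sandwich_mult B)"
  show "rank A = rank B"
    using rank_le_if_semigroup_isomorphic[OF iso]
      rank_le_if_semigroup_isomorphic[OF semigroup_isomorphic_sym[OF iso]]
    by (rule antisym)
next
  assume "rank A = rank B"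
  then show "semigroup_isomorphic (sandwich_mult A) (sandwich_mult B)"
    using equal_rank_imp_equivalent semigroup_isomorphic_if_equivalent by metis
qed

end
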